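(* For every constant $\epsilon>0$, the flow LP for Constrained Connectivity-Sum has an integrality gap of $\Omega(n^{\frac13-\epsilon})$; that is, there are instances with $n$ vertices (for arbitrarily large $n$) on which the minimum number of edges of a safely connected subgraph is $\Omega(n^{\frac13-\epsilon})$ times the optimal value of the flow LP.
   Context: Constrained Connectivity: given a graph $G=(V,E)$, $n=|V|$, and for each ordered pair $(u,v)\in V\times V$ a set $S(u,v)\subseteq V$ with $u,v\in S(u,v)$. A subgraph $H$ of $G$ is safely connected if for every ordered pair $(u,v)$ there is a $u$–$v$ path in $H$ all of whose vertices lie in $S(u,v)$; Constrained Connectivity-Sum minimizes the number of edges of $H$. Let $\mathcal{P}_{uv}$ be the set of $u$–$v$ paths in $G$ contained in $S(u,v)$. The flow LP: minimize $\sum_{e\in E}c_e$ subject to $\sum_{P\in\mathcal{P}_{uv}}f(P)\ge1$ for all $(u,v)$; $\sum_{P\in\mathcal{P}_{uv}:e\in P}f(P)\le c_e$ for all $e\in E$ and all $(u,v)$; $0\le c_e\le1$; $0\le f(P)\le1$. *)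

theory Defs
  imports Complex_Main
begin

text \<open>
  A finite simple undirected graph is a vertex set \<open>V\<close> together with a set \<open>E\<close> of
  two-element subsets of \<open>V\<close>.  The constraint \<open>S\<close> assigns a set to every ordered pair, so
  \<open>S u v\<close> and \<open>S v u\<close> are unrelated.
\<close>

definition cc_instance :: "'a set \<Rightarrow> 'a set set \<Rightarrow> ('a \<Rightarrow> 'a \<Rightarrow> 'a set) \<Rightarrow> bool" where
  "cc_instance V E S \<longleftrightarrow>
     finite V \<and>
     (\<forall>e\<in>E. e \<subseteq> V \<and> card e = 2) \<and>
     (\<forall>u\<in>V. \<forall>v\<in>V. u \<in> S u v \<and> v \<in> S u v \<and> S u v \<subseteq> V)"

definition path_edges :: "'a list \<Rightarrow> 'a set set" where
  "path_edges p = {{p ! i, p ! Suc i} | i. Suc i < length p}"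

definition is_path :: "'a set set \<Rightarrow> 'a \<Rightarrow> 'a \<Rightarrow> 'a list \<Rightarrow> bool" where
  "is_path E u v p \<longleftrightarrow>
     p \<noteq> [] \<and> hd p = u \<and> last p = v \<and> distinct p \<and> path_edges p \<subseteq> E"

text \<open>
  The set \<open>\<P>\<^sub>u\<^sub>v\<close>.  Paths are vertex lists, so a path determines the ordered pair of its
  endpoints and these sets are pairwise disjoint.  The only path from \<open>u\<close> to \<open>u\<close> is the
  list \<open>[u]\<close>, which has no edges.
\<close>

definition safe_paths :: "'a set set \<Rightarrow> ('a \<Rightarrow> 'a \<Rightarrow> 'a set) \<Rightarrow> 'a \<Rightarrow> 'a \<Rightarrow> 'a list set" where
  "safe_paths E S u v = {p. is_path E u v p \<and> set p \<subseteq> S u v}"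

text \<open>
  A safely connected subgraph contains every vertex (take \<open>u = v\<close>), so it is given by its
  edge set \<open>H\<close> alone.
\<close>

definition safely_connected :: "'a set \<Rightarrow> ('a \<Rightarrow> 'a \<Rightarrow> 'a set) \<Rightarrow> 'a set set \<Rightarrow> bool" where
  "safely_connected V S H \<longleftrightarrow> (\<forall>u\<in>V. \<forall>v\<in>V. \<exists>p. p \<in> safe_paths H S u v)"

text \<open>
  The two optimal values below are meaningful for instances with \<open>safely_connected V S E\<close>;
  otherwise both infima are over the empty set.
\<close>

definition cc_sum_opt :: "'a set \<Rightarrow> 'a set set \<Rightarrow> ('a \<Rightarrow> 'a \<Rightarrow> 'a set) \<Rightarrow> nat" where
  "cc_sum_opt V E S = Inf {card H | H. H \<subseteq> E \<and> safely_connected V S H}"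

definition flow_lp_feasible ::
  "'a set \<Rightarrow> 'a set set \<Rightarrow> ('a \<Rightarrow> 'a \<Rightarrow> 'a set) \<Rightarrow> ('a set \<Rightarrow> real) \<Rightarrow> ('a list \<Rightarrow> real) \<Rightarrow> bool"
where
  "flow_lp_feasible V E S c f \<longleftrightarrow>
     (\<forall>u\<in>V. \<forall>v\<in>V. (\<Sum>p\<in>safe_paths E S u v. f p) \<ge> 1) \<and>
     (\<forall>e\<in>E. \<forall>u\<in>V. \<forall>v\<in>V. (\<Sum>p | p \<in> safe_paths E S u v \<and> e \<in> path_edges p. f p) \<le> c e) \<and>
     (\<forall>e\<in>E. 0 \<le> c e \<and> c e \<le> 1) \<and>
     (\<forall>u\<in>V. \<forall>v\<in>V. \<forall>p\<in>safe_paths E S u v. 0 \<le> f p \<and> f p \<le> 1)"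

definition flow_lp_opt :: "'a set \<Rightarrow> 'a set set \<Rightarrow> ('a \<Rightarrow> 'a \<Rightarrow> 'a set) \<Rightarrow> real" where
  "flow_lp_opt V E S = Inf {\<Sum>e\<in>E. c e | c. \<exists>f. flow_lp_feasible V E S c f}"

definition flow_lp_gap :: "'a set \<Rightarrow> 'a set set \<Rightarrow> ('a \<Rightarrow> 'a \<Rightarrow> 'a set) \<Rightarrow> real" where
  "flow_lp_gap V E S = real (cc_sum_opt V E S) / flow_lp_opt V E S"

end

theory Submission
  imports Defs "HOL-Library.FuncSet" "HOL-Library.Countable" "HOL-Number_Theory.Cong"
begin

text \<open>
  The instances encode a random Min-Rep (label cover) problem.  There are \<open>r\<close> groups of \<open>q\<close> labels on
  each of two sides, and for all \<open>i, j < r\<close> the labels of left group \<open>i\<close> are matched with those of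
  right group \<open>j\<close> by a cyclic shift.  Each group also has \<open>q\<close> terminals joined to all its labels, and
  the \<open>a\<close>-th terminals of groups \<open>i\<close> and \<open>j\<close> may only be connected through the labels of these two
  groups.  A hub adjacent to everything serves all other pairs.  Splitting each demand evenly over
  the \<open>q\<close> matching edges gives a fractional solution of cost \<open>O(r q)\<close>.  In a safely connected
  subgraph, the labels adjacent to the \<open>a\<close>-th terminals must cover every superedge.  A family of
  label sets of total size \<open>2 r s\<close> does so for at most \<open>s^(2 r^2)\<close> of the \<open>q^(r^2)\<close> shift systems by
  AM-GM, and there are at most \<open>(2 r q)^(2 r s)\<close> such families; hence for \<open>s\<close> slightly below
  \<open>sqrt q\<close> and \<open>r\<close> a large multiple of \<open>s\<close>, some shift system forces more than \<open>2 r s\<close> edges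
  for each of the \<open>q\<close> values of \<open>a\<close>.  The gap is then of order \<open>s\<close> on about \<open>q^(3/2)\<close> vertices.
\<close>

subsection \<open>Label covers for shift systems\<close>

text \<open>AM-GM, via \<open>y \<le> exp (y - 1)\<close> applied to \<open>y = g x / s\<close>.\<close>

lemma prod_le_power_of_sum_le:
  fixes g :: "'a \<Rightarrow> nat"
  assumes "finite A" "s > 0" "sum g A \<le> card A * s"
  shows "prod g A \<le> s ^ card A"
proof -
  have "real (g x) \<le> s * exp (g x / s - 1)" for x
  proof -
    have "g x / s \<le> exp (g x / s - 1)" using exp_ge_add_one_self[of "g x / s - 1"] by simp
    then show ?thesis using \<open>s > 0\<close> by (simp add: field_simps)
  qed
  then have "(\<Prod>x\<in>A. real (g x)) \<le> (\<Prod>x\<in>A. s * exp (g x / s - 1))"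
    by (intro prod_mono) auto
  also have "\<dots> = real s ^ card A * exp (\<Sum>x\<in>A. g x / s - 1)"
    using assms(1) by (simp add: prod.distrib exp_sum)
  also have "\<dots> \<le> real s ^ card A * 1"
  proof (intro mult_left_mono)
    have "(\<Sum>x\<in>A. g x / s - 1) = real (sum g A) / s - card A"
      by (simp add: sum_subtractf sum_divide_distrib)
    also have "\<dots> \<le> 0"
      using assms(2) of_nat_mono[OF assms(3), where 'a = real] by (simp add: field_simps)
    finally show "exp (\<Sum>x\<in>A. g x / s - 1) \<le> 1" by simp
  qed simp
  finally have "real (prod g A) \<le> real (s ^ card A)" by simp
  then show ?thesis by (simp only: of_nat_le_iff)
qed

text \<open>
  \<open>X\<close> is a set of chosen labels \<open>(side, group, label)\<close>, with \<open>False\<close> for the left side; on the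
  superedge \<open>(i, j)\<close> label \<open>l\<close> of the left group is matched with label \<open>l + w (i, j)\<close> of the right one.
\<close>

definition covers :: "nat \<Rightarrow> (nat \<times> nat \<Rightarrow> nat) \<Rightarrow> (bool \<times> nat \<times> nat) set \<Rightarrow> nat \<Rightarrow> nat \<Rightarrow> bool" where
  "covers q w X i j \<longleftrightarrow> (\<exists>l<q. (False, i, l) \<in> X \<and> (True, j, (l + w (i, j)) mod q) \<in> X)"

lemma covers_mono: "X \<subseteq> Y \<Longrightarrow> covers q w X i j \<Longrightarrow> covers q w Y i j"
  by (auto simp: covers_def)

text \<open>On each superedge a covered shift is the difference of a chosen right and a chosen left
  label, so at most the product of the two group sizes is possible. AM-GM then applies to the
  \<open>2 * r\<close> group sizes, whose mean is \<open>s\<close>.\<close>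

lemma card_covering_shifts:
  fixes X :: "(bool \<times> nat \<times> nat) set"
  assumes "X \<subseteq> UNIV \<times> {..<r} \<times> {..<q}" "card X = 2 * r * s" "s > 0"
  shows "card {w \<in> {..<r} \<times> {..<r} \<rightarrow>\<^sub>E {..<q}. \<forall>i<r. \<forall>j<r. covers q w X i j} \<le> s ^ (2 * r * r)"
proof -
  define A where "A b i = {l. (b, i, l) \<in> X}" for b i
  have A_sub: "A b i \<subseteq> {..<q}" for b i using assms(1) by (auto simp: A_def)
  then have finA [simp]: "finite (A b i)" for b i by (meson finite_lessThan finite_subset)
  define D where "D = (\<lambda>(i, j). {d. d < q \<and> (\<exists>l\<in>A False i. (l + d) mod q \<in> A True j)})"
  have card_D: "card (D ij) \<le> card (A False (fst ij)) * card (A True (snd ij))" for ij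
  proof -
    obtain i j where ij: "ij = (i, j)" by force
    \<comment> \<open>The shift is recovered as \<open>k - l\<close> modulo \<open>q\<close>; adding
      \<open>q\<close> keeps the natural subtraction from truncating.\<close>
    have "D ij \<subseteq> (\<lambda>(l, k). (k + q - l) mod q) ` (A False i \<times> A True j)"
    proof
      fix d assume "d \<in> D ij"
      then obtain l where l: "d < q" "l \<in> A False i" "(l + d) mod q \<in> A True j"
        by (auto simp: D_def ij)
      then have "l < q" using A_sub by blast
      have "((l + d) mod q + q - l) mod q = d"
      proof (cases "l + d < q")
        case False
        then have "(l + d) mod q = l + d - q" using \<open>l < q\<close> l(1) by (simp add: mod_if)
        then show ?thesis using False \<open>l < q\<close> l(1) by simp
      qed (use l(1) in simp_all)
      then show "d \<in> (\<lambda>(l, k). (k + q - l) mod q) ` (A False i \<times> A True j)"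
        using l by (intro image_eqI[of _ _ "(l, (l + d) mod q)"]) auto
    qed
    then have "card (D ij) \<le> card (A False i \<times> A True j)"
      by (rule surj_card_le[rotated]) simp
    then show ?thesis by (simp add: ij card_cartesian_product)
  qed
  have "{w \<in> {..<r} \<times> {..<r} \<rightarrow>\<^sub>E {..<q}. \<forall>i<r. \<forall>j<r. covers q w X i j}
      \<subseteq> PiE ({..<r} \<times> {..<r}) D"
  proof
    fix w assume w: "w \<in> {w \<in> {..<r} \<times> {..<r} \<rightarrow>\<^sub>E {..<q}. \<forall>i<r. \<forall>j<r. covers q w X i j}"
    have "w (i, j) \<in> D (i, j)" if "i < r" "j < r" for i j
    proof -
      have "w (i, j) < q" "covers q w X i j" using w that by (auto simp: PiE_iff)
      then show ?thesis by (auto simp: covers_def A_def D_def)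
    qed
    then show "w \<in> PiE ({..<r} \<times> {..<r}) D"
      using w by (auto simp: PiE_iff)
  qed
  moreover have "finite (PiE ({..<r} \<times> {..<r}) D)"
    by (rule finite_PiE) (auto simp: D_def)
  ultimately have "card {w \<in> {..<r} \<times> {..<r} \<rightarrow>\<^sub>E {..<q}. \<forall>i<r. \<forall>j<r. covers q w X i j}
      \<le> card (PiE ({..<r} \<times> {..<r}) D)"
    by (rule card_mono[rotated])
  also have "\<dots> = (\<Prod>ij\<in>{..<r} \<times> {..<r}. card (D ij))"
    by (simp add: card_PiE)
  also have "\<dots> \<le> (\<Prod>ij\<in>{..<r} \<times> {..<r}. card (A False (fst ij)) * card (A True (snd ij)))"
    by (intro prod_mono) (simp add: card_D)
  also have "\<dots> = (\<Prod>i<r. \<Prod>j<r. card (A False i) * card (A True j))"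
    by (simp add: prod.cartesian_product case_prod_beta)
  \<comment> \<open>Each of the \<open>2 * r\<close> groups lies on exactly \<open>r\<close>
    superedges.\<close>
  also have "\<dots> = (\<Prod>(b, i)\<in>UNIV \<times> {..<r}. card (A b i)) ^ r"
    unfolding prod.cartesian_product[symmetric]
    by (simp add: prod.distrib prod_power_distrib power_mult_distrib UNIV_bool)
  also have "\<dots> \<le> (s ^ card ((UNIV :: bool set) \<times> {..<r})) ^ r"
  proof (intro power_mono prod_le_power_of_sum_le)
    have "bij_betw (\<lambda>((b, i), l). (b, i, l)) (SIGMA bi:UNIV \<times> {..<r}. A (fst bi) (snd bi)) X"
      using assms(1) by (intro bij_betw_byWitness[where f' = "\<lambda>(b, i, l). ((b, i), l)"]) (auto simp: A_def)
    then have "card X = card (SIGMA bi:UNIV \<times> {..<r}. A (fst bi) (snd bi))"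
      by (simp add: bij_betw_same_card)
    then have "card X = (\<Sum>(b, i)\<in>UNIV \<times> {..<r}. card (A b i))"
      by (simp add: card_SigmaI case_prod_beta)
    then show "(\<Sum>(b, i)\<in>UNIV \<times> {..<r}. card (A b i)) \<le> card ((UNIV :: bool set) \<times> {..<r}) * s"
      using assms(2) by (simp add: card_cartesian_product)
  qed (use \<open>s > 0\<close> in auto)
  also have "\<dots> = s ^ (2 * r * r)"
    by (simp add: card_cartesian_product flip: power_mult)
  finally show ?thesis .
qed

text \<open>Union bound over the families of exactly \<open>2 * r * s\<close> labels: together they
  cover fewer shift systems than there are.\<close>

lemma exists_shifts_without_small_cover:
  assumes "(2 * r * q) ^ (2 * r * s) * s ^ (2 * r * r) < q ^ (r * r)" "0 < s" "s \<le> q"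
  obtains w where "\<And>X. X \<subseteq> UNIV \<times> {..<r} \<times> {..<q} \<Longrightarrow> \<forall>i<r. \<forall>j<r. covers q w X i j
    \<Longrightarrow> 2 * r * s < card X"
proof -
  define M where "M = (UNIV :: bool set) \<times> {..<r} \<times> {..<q}"
  define \<X> where "\<X> = {X. X \<subseteq> M \<and> card X = 2 * r * s}"
  define \<W> where "\<W> = {..<r} \<times> {..<r} \<rightarrow>\<^sub>E {..<q}"
  define W where "W X = {w \<in> \<W>. \<forall>i<r. \<forall>j<r. covers q w X i j}" for X
  have finM: "finite M" and cardM: "card M = 2 * r * q"
    by (simp_all add: M_def card_cartesian_product)
  have small: "2 * r * s \<le> card M" using assms(3) by (simp add: cardM)
  have fin: "finite \<X>" using finM by (simp add: \<X>_def)
  have "card (\<Union>X\<in>\<X>. W X) \<le> (\<Sum>X\<in>\<X>. card (W X))"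
    by (rule card_UN_le[OF fin])
  also have "\<dots> \<le> card \<X> * s ^ (2 * r * r)"
  proof (rule order_trans[OF sum_bounded_above[where K = "s ^ (2 * r * r)"]])
    show "card (W X) \<le> s ^ (2 * r * r)" if "X \<in> \<X>" for X
      using card_covering_shifts[OF _ _ assms(2), of X r q] that
      by (simp add: \<X>_def W_def \<W>_def M_def)
  qed simp
  also have "card \<X> \<le> (2 * r * q) ^ (2 * r * s)"
    using binomial_le_pow[OF small] by (simp add: \<X>_def n_subsets[OF finM] cardM)
  finally have "card (\<Union>X\<in>\<X>. W X) < q ^ (r * r)"
    using assms(1) by simp
  also have "\<dots> = card \<W>"
    by (simp add: \<W>_def card_PiE)
  finally have less: "card (\<Union>X\<in>\<X>. W X) < card \<W>" .
  have "finite \<W>"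
    unfolding \<W>_def by (intro finite_PiE) auto
  then have "finite (W X)" for X
    by (rule finite_subset[rotated]) (auto simp: W_def)
  then have "finite (\<Union>X\<in>\<X>. W X)"
    using fin by simp
  then have "\<not> \<W> \<subseteq> (\<Union>X\<in>\<X>. W X)"
    using card_mono[of "\<Union>X\<in>\<X>. W X" \<W>] less by linarith
  then obtain w where w: "w \<in> \<W>" "w \<notin> (\<Union>X\<in>\<X>. W X)"
    by blast
  show thesis
  proof (rule that[of w], rule ccontr)
    fix X assume X: "X \<subseteq> UNIV \<times> {..<r} \<times> {..<q}" "\<forall>i<r. \<forall>j<r. covers q w X i j"
      "\<not> 2 * r * s < card X"
    then have "card X \<le> 2 * r * s" "X \<subseteq> M"
      by (simp_all add: M_def)
    \<comment> \<open>A smaller cover is padded to the exact size that was counted and remains a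
      cover.\<close>
    from exists_subset_between[OF this(1) small this(2) finM]
    obtain Y where Y: "X \<subseteq> Y" "Y \<subseteq> M" "card Y = 2 * r * s"
      by blast
    have "covers q w Y i j" if "i < r" "j < r" for i j
      using covers_mono[OF Y(1)] X(2) that by simp
    then have "w \<in> W Y" using w(1) by (simp add: W_def)
    then show False using w(2) Y(2,3) unfolding \<X>_def by blast
  qed
qed

subsection \<open>Paths and uniform fractional flows\<close>

lemma finite_safe_paths: "finite (S u v) \<Longrightarrow> finite (safe_paths E S u v)"
  by (rule finite_subset[OF _ finite_subset_distinct[of "S u v"]])
    (auto simp: safe_paths_def is_path_def)

lemma path_edges_Cons [simp]:
  "path_edges [x] = {}" "path_edges (x # y # p) = insert {x, y} (path_edges (y # p))"
proof -
  show "path_edges [x] = {}" by (simp add: path_edges_def)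
  show "path_edges (x # y # p) = insert {x, y} (path_edges (y # p))"
  proof (intro set_eqI iffI)
    fix e assume "e \<in> path_edges (x # y # p)"
    then obtain i where "e = {(x # y # p) ! i, (x # y # p) ! Suc i}" "Suc i < length (x # y # p)"
      by (auto simp: path_edges_def)
    then show "e \<in> insert {x, y} (path_edges (y # p))"
      by (cases i) (auto simp: path_edges_def)
  next
    fix e assume "e \<in> insert {x, y} (path_edges (y # p))"
    then show "e \<in> path_edges (x # y # p)"
      unfolding path_edges_def by (auto intro: exI[of _ "0::nat"] exI[of _ "Suc _"])
  qed
qed

text \<open>Serves to refute the existence of a safe path: exhibit a set closed under allowed steps
  that contains the start but misses the end.\<close>

lemma path_stays_in_closed_set:
  assumes "path_edges p \<subseteq> E" "set p \<subseteq> S" "p \<noteq> []" "hd p \<in> R"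
    and closed: "\<And>x y. x \<in> R \<Longrightarrow> y \<in> S \<Longrightarrow> {x, y} \<in> E \<Longrightarrow> y \<in> R"
  shows "last p \<in> R"
  using assms(1-4)
proof (induction p)
  case (Cons x p)
  then show ?case by (cases p) (auto dest: closed)
qed simp

text \<open>Each pair splits one unit evenly over \<open>F u v\<close>, so the flow across
  \<open>e\<close> is the fraction of these paths using \<open>e\<close>, and feasibility becomes
  counting.\<close>

lemma flow_lp_feasible_uniform:
  fixes c :: "'a set \<Rightarrow> real"
  assumes "cc_instance V E S"
    and F: "\<And>u v. u \<in> V \<Longrightarrow> v \<in> V \<Longrightarrow> F u v \<noteq> {} \<and> F u v \<subseteq> safe_paths E S u v"
    and c: "\<And>e. e \<in> E \<Longrightarrow> 0 \<le> c e \<and> c e \<le> 1"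
    and load: "\<And>e u v. e \<in> E \<Longrightarrow> u \<in> V \<Longrightarrow> v \<in> V \<Longrightarrow>
      real (card {p \<in> F u v. e \<in> path_edges p}) \<le> c e * card (F u v)"
  shows "\<exists>f. flow_lp_feasible V E S c f"
proof -
  \<comment> \<open>One function can serve all pairs, because a path determines its
    endpoints.\<close>
  define f where "f p = (if p \<in> F (hd p) (last p) then 1 / card (F (hd p) (last p)) else 0 :: real)"
    for p :: "'a list"
  have fin: "finite (safe_paths E S u v)" if "u \<in> V" "v \<in> V" for u v
    using assms(1) that unfolding cc_instance_def by (meson finite_safe_paths finite_subset)
  have f: "f p = (if p \<in> F u v then 1 / card (F u v) else 0)" if "p \<in> safe_paths E S u v" for p u v
    using that by (auto simp: f_def safe_paths_def is_path_def)
  have pos: "card (F u v) > 0" if "u \<in> V" "v \<in> V" for u v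
    using F fin that by (meson card_gt_0_iff finite_subset)
  have sum_f: "(\<Sum>p | p \<in> safe_paths E S u v \<and> Q p. f p) = card {p \<in> F u v. Q p} / card (F u v)"
    if "u \<in> V" "v \<in> V" for u v Q
  proof -
    have "(\<Sum>p | p \<in> safe_paths E S u v \<and> Q p. f p) =
        (\<Sum>p | p \<in> safe_paths E S u v \<and> Q p. if p \<in> F u v then 1 / card (F u v) else 0)"
      by (rule sum.cong) (auto simp: f)
    also have "\<dots> = (\<Sum>p | p \<in> F u v \<and> Q p. 1 / card (F u v))"
      using F[OF that] fin[OF that] by (intro sum.mono_neutral_cong_right) auto
    finally show ?thesis by simp
  qed
  have "flow_lp_feasible V E S c f"
    unfolding flow_lp_feasible_def
  proof (intro conjI ballI)
    fix u v assume uv: "u \<in> V" "v \<in> V"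
    show "(\<Sum>p\<in>safe_paths E S u v. f p) \<ge> 1"
      using sum_f[OF uv, of "\<lambda>_. True"] pos[OF uv] by simp
    fix e assume "e \<in> E"
    then show "(\<Sum>p | p \<in> safe_paths E S u v \<and> e \<in> path_edges p. f p) \<le> c e"
      using load[OF _ uv] pos[OF uv] by (simp add: sum_f[OF uv] divide_le_eq)
  next
    fix u v p assume uv: "u \<in> V" "v \<in> V" and p: "p \<in> safe_paths E S u v"
    show "0 \<le> f p" "f p \<le> 1" using pos[OF uv] by (simp_all add: f[OF p] divide_le_eq)
  qed (use c in auto)
  then show ?thesis by blast
qed

subsection \<open>The label gadget\<close>

text \<open>Vertex names stay abstract so that any injective encoding can be plugged in;
  \<open>neq\<close> gives both orientations for rewriting.\<close>

locale label_gadget =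
  fixes hub :: 'a and terminal label :: "bool \<Rightarrow> nat \<Rightarrow> nat \<Rightarrow> 'a"
    and r q :: nat and w :: "nat \<times> nat \<Rightarrow> nat"
  assumes terminal_eq [simp]: "terminal b i a = terminal b' i' a' \<longleftrightarrow> b = b' \<and> i = i' \<and> a = a'"
    and label_eq [simp]: "label b i l = label b' i' l' \<longleftrightarrow> b = b' \<and> i = i' \<and> l = l'"
    and neq [simp]: "terminal b i a \<noteq> label b' i' l" "label b' i' l \<noteq> terminal b i a"
      "hub \<noteq> terminal b i a" "terminal b i a \<noteq> hub" "hub \<noteq> label b i l" "label b i l \<noteq> hub"
    and r_pos: "r > 0" and q_pos: "q > 0"
begin

definition idx :: "(bool \<times> nat \<times> nat) set" where
  "idx = UNIV \<times> {..<r} \<times> {..<q}"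

definition spokes :: "'a set" where
  "spokes = (\<lambda>(b, i, a). terminal b i a) ` idx \<union> (\<lambda>(b, i, l). label b i l) ` idx"

definition verts :: "'a set" where
  "verts = insert hub spokes"

definition hub_edges :: "'a set set" where
  "hub_edges = (\<lambda>x. {hub, x}) ` spokes"

definition choice_edges :: "'a set set" where
  "choice_edges = (\<lambda>((b, i, a), l). {terminal b i a, label b i l}) ` (idx \<times> {..<q})"

definition shift :: "nat \<Rightarrow> nat \<Rightarrow> nat \<Rightarrow> nat" where
  "shift i j l = (l + w (i, j)) mod q"

definition match_edges :: "'a set set" where
  "match_edges = (\<lambda>(i, j, l). {label False i l, label True j (shift i j l)}) ` ({..<r} \<times> {..<r} \<times> {..<q})"

definition edges :: "'a set set" where
  "edges = hub_edges \<union> choice_edges \<union> match_edges"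

text \<open>
  Only terminals with the same copy index \<open>a\<close> are linked by a demand, so that distinct copies
  need disjoint sets of choice edges; every other pair is served through the hub.
\<close>

definition demand :: "'a \<Rightarrow> 'a \<Rightarrow> nat \<Rightarrow> nat \<Rightarrow> nat \<Rightarrow> bool" where
  "demand u v i j a \<longleftrightarrow> i < r \<and> j < r \<and> a < q \<and> u = terminal False i a \<and> v = terminal True j a"

text \<open>The hub is left out, so that a demand cannot bypass the labels.\<close>

definition gate :: "nat \<Rightarrow> nat \<Rightarrow> nat \<Rightarrow> 'a set" where
  "gate i j a = {terminal False i a, terminal True j a} \<union> label False i ` {..<q} \<union> label True j ` {..<q}"

text \<open>Injectivity of \<open>terminal\<close> makes the indices of a demand unique, so the
  existential selects a single gate.\<close>

definition allowed :: "'a \<Rightarrow> 'a \<Rightarrow> 'a set" where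
  "allowed u v = {x. if \<exists>i j a. demand u v i j a then \<exists>i j a. demand u v i j a \<and> x \<in> gate i j a
     else x \<in> {u, v, hub}}"

lemma allowed_terminal:
  "i < r \<Longrightarrow> j < r \<Longrightarrow> a < q \<Longrightarrow> allowed (terminal False i a) (terminal True j a) = gate i j a"
  by (auto simp: allowed_def demand_def)

lemma allowed_hub: "\<not> (\<exists>i j a. demand u v i j a) \<Longrightarrow> allowed u v = {u, v, hub}"
  by (auto simp: allowed_def)

lemma in_verts [simp]:
  "hub \<in> verts" "terminal b i a \<in> verts \<longleftrightarrow> i < r \<and> a < q" "label b i l \<in> verts \<longleftrightarrow> i < r \<and> l < q"
  by (auto simp: verts_def spokes_def idx_def image_iff)

lemma finite_idx [simp]: "finite idx" and card_idx: "card idx = 2 * r * q"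
  by (auto simp: idx_def card_cartesian_product)

lemma shift_less [simp]: "shift i j l < q"
  using q_pos by (simp add: shift_def)

lemma shift_inj: "l < q \<Longrightarrow> l' < q \<Longrightarrow> shift i j l = shift i j l' \<longleftrightarrow> l = l'"
  by (metis cong_def cong_add_rcancel_nat mod_less shift_def)

lemma finite_spokes [simp]: "finite spokes"
  by (simp add: spokes_def)

lemma card_spokes: "card spokes = 4 * r * q"
proof -
  have "card spokes = card ((\<lambda>(b, i, a). terminal b i a) ` idx) + card ((\<lambda>(b, i, l). label b i l) ` idx)"
    unfolding spokes_def by (intro card_Un_disjoint) auto
  moreover have "inj_on (\<lambda>(b, i, a). terminal b i a) idx" "inj_on (\<lambda>(b, i, l). label b i l) idx"
    by (auto simp: inj_on_def)
  ultimately show ?thesis by (simp add: card_image card_idx)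
qed

lemma hub_notin_spokes [simp]: "hub \<notin> spokes"
  by (auto simp: spokes_def)

lemma card_verts: "card verts = 4 * r * q + 1"
  by (simp add: verts_def card_spokes)

lemma cc_instance: "cc_instance verts edges allowed"
  unfolding cc_instance_def
proof (intro conjI ballI)
  show "finite verts" by (simp add: verts_def)
next
  fix e assume "e \<in> edges"
  then show "e \<subseteq> verts" "card e = 2"
    by (auto simp: edges_def hub_edges_def choice_edges_def match_edges_def idx_def card_insert_if)
      (auto simp: verts_def)
next
  fix u v assume uv: "u \<in> verts" "v \<in> verts"
  show "u \<in> allowed u v" "v \<in> allowed u v" "allowed u v \<subseteq> verts"
    by (cases "\<exists>i j a. demand u v i j a"; use uv in \<open>auto simp: allowed_terminal demand_def gate_def allowed_hub\<close>)+
qed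

section \<open>Lower bound for safely connected subgraphs\<close>

lemma choice_edgeD:
  assumes "{terminal b i a, label b' i' l} \<in> edges"
  shows "b' = b \<and> i' = i"
  using assms by (auto simp: edges_def hub_edges_def choice_edges_def match_edges_def
      doubleton_eq_iff idx_def)

lemma no_terminal_edge: "{terminal b i a, terminal b' i' a'} \<notin> edges"
  by (auto simp: edges_def hub_edges_def choice_edges_def match_edges_def
      doubleton_eq_iff idx_def)

lemma match_edgeD:
  assumes "{label False i l, label True j l'} \<in> edges"
  shows "l' = shift i j l"
  using assms by (auto simp: edges_def hub_edges_def choice_edges_def match_edges_def
      doubleton_eq_iff idx_def)

lemma no_label_edge: "{label b i l, label b j l'} \<notin> edges"
  by (auto simp: edges_def hub_edges_def choice_edges_def match_edges_def
      doubleton_eq_iff idx_def)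

text \<open>The label family that \<open>H\<close> encodes for copy \<open>a\<close>, with one
  choice edge per label.\<close>

definition chosen :: "'a set set \<Rightarrow> nat \<Rightarrow> (bool \<times> nat \<times> nat) set" where
  "chosen H a = {(b, i, l) \<in> idx. {terminal b i a, label b i l} \<in> H}"

text \<open>Without a covering pair, a walk from the left terminal inside the gate reaches only its
  chosen labels and their partners, none of which is joined to the right terminal in
  \<open>H\<close>.\<close>

lemma safe_path_imp_covers:
  assumes H: "H \<subseteq> edges" and ij: "i < r" "j < r" "a < q"
    and p: "p \<in> safe_paths H allowed (terminal False i a) (terminal True j a)"
  shows "covers q w (chosen H a) i j"
proof (rule ccontr)
  assume no: "\<not> covers q w (chosen H a) i j"
  define A where "A = {l. l < q \<and> {terminal False i a, label False i l} \<in> H}"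
  \<comment> \<open>the vertices reachable from \<open>terminal False i a\<close> within the gate if nothing is covered\<close>
  define R where "R = {terminal False i a} \<union> label False i ` A \<union> label True j ` shift i j ` A"
  have noA: "{terminal True j a, label True j (shift i j l)} \<notin> H" if "l \<in> A" for l
    using no that ij by (auto simp: covers_def chosen_def A_def idx_def shift_def[symmetric])
  have matched: "k = shift i j l" if "{label False i l, label True j k} \<in> H" for l k
    using H that match_edgeD by blast
  have "last p \<in> R"
  proof (rule path_stays_in_closed_set[of p H "gate i j a"])
    show "path_edges p \<subseteq> H" "set p \<subseteq> gate i j a" "p \<noteq> []" "hd p \<in> R"
      using p ij by (auto simp: safe_paths_def is_path_def allowed_terminal R_def)
    fix x y assume xy: "x \<in> R" "y \<in> gate i j a" "{x, y} \<in> H"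
    then consider "x = terminal False i a" | l where "l \<in> A" "x = label False i l"
      | l where "l \<in> A" "x = label True j (shift i j l)"
      by (auto simp: R_def)
    then show "y \<in> R"
    proof cases
      case 1
      then show ?thesis
        using xy H ij by (auto simp: R_def A_def gate_def no_terminal_edge dest: choice_edgeD)
    next
      case 2
      then have no: "{terminal True j a, label False i l} \<notin> H"
        using H choice_edgeD by blast
      have k: "k = shift i j l" if "y = label True j k" for k
        using matched[of l k] xy 2 that by simp
      then show ?thesis
        using xy 2 no_label_edge[of False i l i] H k no
        by (auto simp: R_def gate_def insert_commute)
    next
      case 3
      have "l < q" using 3 by (simp add: A_def)
      \<comment> \<open>Going back over the matching only returns to \<open>l\<close>, since shifts
        are injective; the exit to the right terminal is barred by \<open>noA\<close>.\<close>
      have k: "k = l" if "y = label False i k" "k < q" for k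
        using matched[of k "shift i j l"] xy 3 that \<open>l < q\<close>
        by (simp add: insert_commute shift_inj)
      have "{label True j (shift i j l), label True j k} \<notin> H" for k
        using H no_label_edge by blast
      then show ?thesis
        using xy 3 noA[OF 3(1)] k by (auto simp: R_def gate_def insert_commute)
    qed
  qed
  moreover have "last p = terminal True j a"
    using p by (simp add: safe_paths_def is_path_def)
  ultimately show False by (auto simp: R_def)
qed

text \<open>Each of the \<open>q\<close> copies needs its own cover, and a choice edge reveals its
  copy through its terminal, so the covers are paid for by disjoint sets of edges.\<close>

lemma card_safely_connected_ge:
  assumes H: "H \<subseteq> edges" and conn: "safely_connected verts allowed H"
    and w: "\<And>X. X \<subseteq> UNIV \<times> {..<r} \<times> {..<q} \<Longrightarrow> \<forall>i<r. \<forall>j<r. covers q w X i j \<Longrightarrow> K \<le> card X"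
  shows "q * K \<le> card H"
proof -
  have "K \<le> card (chosen H a)" if "a < q" for a
  proof (rule w)
    show "chosen H a \<subseteq> UNIV \<times> {..<r} \<times> {..<q}" by (auto simp: chosen_def idx_def)
    show "\<forall>i<r. \<forall>j<r. covers q w (chosen H a) i j"
      using conn that safe_path_imp_covers[OF H] unfolding safely_connected_def
      by (meson in_verts(2))
  qed
  then have "(\<Sum>a<q. K) \<le> (\<Sum>a<q. card (chosen H a))"
    by (intro sum_mono) auto
  also have "\<dots> = card (SIGMA a:{..<q}. chosen H a)"
    by (subst card_SigmaI) (auto simp: chosen_def intro: finite_subset[OF _ finite_idx])
  also have "\<dots> \<le> card H"
  proof (rule card_inj_on_le)
    show "inj_on (\<lambda>(a, b, i, l). {terminal b i a, label b i l}) (SIGMA a:{..<q}. chosen H a)"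
      by (auto simp: inj_on_def doubleton_eq_iff)
    show "(\<lambda>(a, b, i, l). {terminal b i a, label b i l}) ` (SIGMA a:{..<q}. chosen H a) \<subseteq> H"
      by (auto simp: chosen_def)
    show "finite H"
      using H by (rule finite_subset)
        (simp add: edges_def hub_edges_def choice_edges_def match_edges_def)
  qed
  finally show ?thesis by simp
qed

section \<open>Fractional solution and bounds on the LP value\<close>

definition gate_path :: "nat \<Rightarrow> nat \<Rightarrow> nat \<Rightarrow> nat \<Rightarrow> 'a list" where
  "gate_path i j a l =
     [terminal False i a, label False i l, label True j (shift i j l), terminal True j a]"

definition hub_path :: "'a \<Rightarrow> 'a \<Rightarrow> 'a list" where
  "hub_path u v = (if u = v then [u] else if hub \<in> {u, v} then [u, v] else [u, hub, v])"

text \<open>The support of the fractional flow.\<close>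

definition routes :: "'a \<Rightarrow> 'a \<Rightarrow> 'a list set" where
  "routes u v = {p. if \<exists>i j a. demand u v i j a then \<exists>i j a. demand u v i j a \<and> p \<in> gate_path i j a ` {..<q}
     else p = hub_path u v}"

lemma routes_demand:
  "i < r \<Longrightarrow> j < r \<Longrightarrow> a < q \<Longrightarrow>
    routes (terminal False i a) (terminal True j a) = gate_path i j a ` {..<q}"
  by (auto simp: routes_def demand_def)

lemma routes_hub: "\<not> (\<exists>i j a. demand u v i j a) \<Longrightarrow> routes u v = {hub_path u v}"
  by (auto simp: routes_def)

lemma hub_edge: "x \<in> verts \<Longrightarrow> x \<noteq> hub \<Longrightarrow> {hub, x} \<in> edges" "x \<in> verts \<Longrightarrow> x \<noteq> hub \<Longrightarrow> {x, hub} \<in> edges"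
  by (auto simp: edges_def hub_edges_def verts_def insert_commute)

lemma gate_path_safe:
  assumes "i < r" "j < r" "a < q" "l < q"
  shows "gate_path i j a l \<in> safe_paths edges allowed (terminal False i a) (terminal True j a)"
proof -
  have "{terminal False i a, label False i l} \<in> edges"
    using assms by (force simp: edges_def choice_edges_def idx_def)
  moreover have "{terminal True j a, label True j (shift i j l)} \<in> edges"
    using assms by (force simp: edges_def choice_edges_def idx_def)
  moreover have "{label False i l, label True j (shift i j l)} \<in> edges"
    using assms by (force simp: edges_def match_edges_def)
  ultimately show ?thesis
    using assms by (simp add: safe_paths_def is_path_def gate_path_def allowed_terminal gate_def insert_commute)
qed

lemma routes_safe:
  assumes "u \<in> verts" "v \<in> verts"
  shows "routes u v \<noteq> {} \<and> routes u v \<subseteq> safe_paths edges allowed u v"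
proof (cases "\<exists>i j a. demand u v i j a")
  case True
  then show ?thesis
    using q_pos gate_path_safe by (auto simp: demand_def routes_demand)
next
  case False
  then show ?thesis
    using assms hub_edge[of u] hub_edge[of v]
    by (auto simp: routes_hub allowed_hub safe_paths_def is_path_def hub_path_def)
qed

lemma safely_connected: "safely_connected verts allowed edges"
  using routes_safe unfolding safely_connected_def by blast

text \<open>A hub path carries a full unit, while a demand puts at most \<open>1 / q\<close> on any
  edge.\<close>

definition cap :: "'a set \<Rightarrow> real" where
  "cap e = (if hub \<in> e then 1 else 1 / q)"

text \<open>The \<open>q\<close> gate paths of a demand are pairwise edge-disjoint, since each edge
  of such a path determines its label \<open>l\<close>; a hub path uses only edges of capacity
  1.\<close>

lemma routes_load:
  assumes "e \<in> edges" "u \<in> verts" "v \<in> verts"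
  shows "real (card {p \<in> routes u v. e \<in> path_edges p}) \<le> cap e * card (routes u v)"
proof (cases "\<exists>i j a. demand u v i j a")
  case True
  then obtain i j a where d: "i < r" "j < r" "a < q" "u = terminal False i a" "v = terminal True j a"
    by (auto simp: demand_def)
  have "inj_on (gate_path i j a) {..<q}"
    by (auto simp: inj_on_def gate_path_def)
  then have card: "card (routes u v) = q"
    using d by (simp add: routes_demand card_image)
  have uniq: "p = p'" if p: "p \<in> routes u v" "e \<in> path_edges p" "p' \<in> routes u v" "e \<in> path_edges p'" for p p'
  proof -
    obtain l l' where l: "l < q" "l' < q" "p = gate_path i j a l" "p' = gate_path i j a l'"
      using p(1,3) d by (auto simp: routes_demand)
    then have "l = l'"
      using l p(2,4) by (auto simp: gate_path_def doubleton_eq_iff shift_inj)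
    then show ?thesis using l by simp
  qed
  have "card {p \<in> routes u v. e \<in> path_edges p} \<le> 1"
    using uniq by (subst One_nat_def, subst card_le_Suc0_iff_eq) (simp_all add: routes_demand d)
  moreover have "1 \<le> cap e * q"
    using q_pos by (simp add: cap_def)
  ultimately show ?thesis unfolding card by linarith
next
  case False
  have "hub \<in> e" if "e \<in> path_edges (hub_path u v)"
    using that by (auto simp: hub_path_def split: if_splits)
  moreover have "{p \<in> routes u v. e \<in> path_edges p} =
      (if e \<in> path_edges (hub_path u v) then {hub_path u v} else {})"
    using False by (auto simp: routes_hub)
  ultimately show ?thesis
    using False by (simp add: routes_hub cap_def)
qed

lemma cap_feasible: "\<exists>f. flow_lp_feasible verts edges allowed cap f"
  by (rule flow_lp_feasible_uniform[where F = routes, OF cc_instance routes_safe _ routes_load])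
    (use q_pos in \<open>auto simp: cap_def\<close>)

text \<open>At most \<open>4 * r * q\<close> hub edges cost 1 each; at most
  \<open>2 * r * q * q\<close> choice edges and \<open>r * r * q\<close> matching edges cost
  \<open>1 / q\<close> each.\<close>

lemma sum_cap: "(\<Sum>e\<in>edges. cap e) \<le> 6 * r * q + r * r"
proof -
  let ?rest = "choice_edges \<union> match_edges"
  have fin: "finite hub_edges" "finite choice_edges" "finite match_edges"
    by (simp_all add: hub_edges_def choice_edges_def match_edges_def)
  have "card hub_edges \<le> 4 * r * q"
    using card_image_le[OF finite_spokes] by (simp add: hub_edges_def card_spokes)
  then have "real (card hub_edges) \<le> 4 * r * q"
    by (simp only: of_nat_le_iff)
  moreover have "cap e = 1" if "e \<in> hub_edges" for e
    using that by (auto simp: cap_def hub_edges_def)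
  ultimately have hub_sum: "(\<Sum>e\<in>hub_edges. cap e) \<le> 4 * r * q"
    by simp
  have "card choice_edges \<le> 2 * r * q * q"
    unfolding choice_edges_def
    by (rule order_trans[OF card_image_le]) (simp_all add: card_cartesian_product card_idx)
  moreover have "card match_edges \<le> r * r * q"
    unfolding match_edges_def
    by (rule order_trans[OF card_image_le]) (simp_all add: card_cartesian_product)
  ultimately have "card ?rest \<le> q * (2 * r * q + r * r)"
    using card_Un_le[of choice_edges match_edges] by (simp add: algebra_simps)
  then have "real (card ?rest) \<le> q * (2 * r * q + r * r)"
    by (simp only: of_nat_le_iff)
  moreover have "cap e = 1 / q" if "e \<in> ?rest" for e
    using that by (auto simp: cap_def choice_edges_def match_edges_def)
  ultimately have rest_sum: "(\<Sum>e\<in>?rest. cap e) \<le> 2 * r * q + r * r"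
    using q_pos by (simp add: divide_le_eq mult.commute)
  have "(\<Sum>e\<in>edges. cap e) = (\<Sum>e\<in>hub_edges. cap e) + (\<Sum>e\<in>?rest. cap e) - (\<Sum>e\<in>hub_edges \<inter> ?rest. cap e)"
    unfolding edges_def Un_assoc using fin by (intro sum_Un) auto
  also have "\<dots> \<le> (\<Sum>e\<in>hub_edges. cap e) + (\<Sum>e\<in>?rest. cap e)"
    by (simp add: sum_nonneg cap_def)
  finally show ?thesis using hub_sum rest_sum by simp
qed

text \<open>The lower bound makes the denominator of the gap positive. It comes from a pair served
  by a single edge, whose capacity must then be at least 1.\<close>

lemma flow_lp_opt_bounds:
  "1 \<le> flow_lp_opt verts edges allowed" "flow_lp_opt verts edges allowed \<le> 6 * r * q + r * r"
proof -
  let ?vals = "{\<Sum>e\<in>edges. c e | c. \<exists>f. flow_lp_feasible verts edges allowed c f}"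
  have lower: "1 \<le> (\<Sum>e\<in>edges. c e)" if lp: "flow_lp_feasible verts edges allowed c f" for c f
  proof -
    \<comment> \<open>Any terminal would do; this one exists because \<open>r\<close> and
      \<open>q\<close> are positive. The hub is in no demand, so only the direct edge is
      allowed.\<close>
    define t where "t = terminal False 0 0"
    have t: "t \<in> verts" "t \<noteq> hub" using r_pos q_pos by (auto simp: t_def)
    have e: "{hub, t} \<in> edges" using t by (rule hub_edge)
    have allowed: "allowed hub t = {hub, t}"
      by (auto simp: allowed_def demand_def)
    have "p = [hub, t]" if "p \<in> safe_paths edges allowed hub t" for p
    proof -
      have p: "p \<noteq> []" "hd p = hub" "last p = t" "distinct p" "set p \<subseteq> {hub, t}"
        using that by (auto simp: safe_paths_def is_path_def allowed)
      then obtain p' where p': "p = hub # p'" by (cases p) auto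
      then have "set p' \<subseteq> {t}" "p' \<noteq> []" using p t by auto
      then obtain p'' where "p' = t # p''" by (cases p') auto
      moreover then have "p'' = []" using \<open>set p' \<subseteq> {t}\<close> p p' by (cases p'') auto
      ultimately show ?thesis using p' by simp
    qed
    then have "{p. p \<in> safe_paths edges allowed hub t \<and> {hub, t} \<in> path_edges p}
        = safe_paths edges allowed hub t"
      by force
    moreover have "1 \<le> (\<Sum>p\<in>safe_paths edges allowed hub t. f p)"
      using lp t unfolding flow_lp_feasible_def by simp
    moreover have "(\<Sum>p | p \<in> safe_paths edges allowed hub t \<and> {hub, t} \<in> path_edges p. f p) \<le> c {hub, t}"
      using lp e t unfolding flow_lp_feasible_def by simp
    ultimately have "1 \<le> c {hub, t}"
      by simp
    also have "\<dots> \<le> (\<Sum>e\<in>edges. c e)"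
      using lp e by (intro member_le_sum)
        (auto simp: flow_lp_feasible_def edges_def hub_edges_def choice_edges_def match_edges_def)
    finally show ?thesis .
  qed
  obtain f where f: "flow_lp_feasible verts edges allowed cap f"
    using cap_feasible by blast
  show "1 \<le> flow_lp_opt verts edges allowed"
    unfolding flow_lp_opt_def using f lower by (intro cInf_greatest) auto
  have "flow_lp_opt verts edges allowed \<le> (\<Sum>e\<in>edges. cap e)"
    unfolding flow_lp_opt_def using f lower by (intro cInf_lower) (auto intro!: bdd_belowI[of _ 1])
  then show "flow_lp_opt verts edges allowed \<le> 6 * r * q + r * r"
    using sum_cap by linarith
qed

section \<open>Integrality gap of one gadget\<close>

lemma cc_sum_opt_ge:
  assumes "\<And>X. X \<subseteq> UNIV \<times> {..<r} \<times> {..<q} \<Longrightarrow> \<forall>i<r. \<forall>j<r. covers q w X i j \<Longrightarrow> K \<le> card X"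
  shows "q * K \<le> cc_sum_opt verts edges allowed"
proof -
  \<comment> \<open>As \<open>edges\<close> is itself safely connected, the infimum is attained by
    some \<open>H\<close>.\<close>
  have "{card H | H. H \<subseteq> edges \<and> safely_connected verts allowed H} \<noteq> {}"
    using safely_connected by blast
  then have "cc_sum_opt verts edges allowed
      \<in> {card H | H. H \<subseteq> edges \<and> safely_connected verts allowed H}"
    unfolding cc_sum_opt_def by (rule Inf_nat_def1)
  then show ?thesis
    using card_safely_connected_ge[OF _ _ assms] by auto
qed

text \<open>The integral cost is at least \<open>2 * r * s * q\<close>, and \<open>r \<le> q\<close>
  bounds the LP value by \<open>7 * r * q\<close>.\<close>

lemma flow_lp_gap_ge:
  assumes "\<And>X. X \<subseteq> UNIV \<times> {..<r} \<times> {..<q} \<Longrightarrow> \<forall>i<r. \<forall>j<r. covers q w X i j \<Longrightarrow> 2 * r * s < card X"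
    and "r \<le> q"
  shows "2 / 7 * real s \<le> flow_lp_gap verts edges allowed"
proof -
  have "q * (2 * r * s) \<le> cc_sum_opt verts edges allowed"
    using assms(1) by (intro cc_sum_opt_ge) (simp add: less_imp_le)
  then have opt: "real (q * (2 * r * s)) \<le> cc_sum_opt verts edges allowed"
    by (simp only: of_nat_le_iff)
  have "6 * r * q + r * r \<le> 7 * r * q"
    using mult_le_mono2[OF \<open>r \<le> q\<close>, of r] by simp
  then have "real (6 * r * q + r * r) \<le> real (7 * r * q)"
    by (simp only: of_nat_le_iff)
  then have lp: "flow_lp_opt verts edges allowed \<le> real (7 * r * q)"
    using flow_lp_opt_bounds(2) by linarith
  have "2 / 7 * real s = real (q * (2 * r * s)) / real (7 * r * q)"
    using r_pos q_pos by (simp add: field_simps)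
  also have "\<dots> \<le> real (cc_sum_opt verts edges allowed) / flow_lp_opt verts edges allowed"
    using opt lp flow_lp_opt_bounds(1) by (intro frac_le) auto
  finally show ?thesis by (simp add: flow_lp_gap_def)
qed

end

subsection \<open>Choice of parameters\<close>

text \<open>
  Since \<open>(t * s)^2 = q\<close>, the counting inequality reduces to \<open>(2 * r * q) ^ (2 * r * s) < t ^ (2 * r * r)\<close>,
  and with \<open>2 * r \<le> q\<close> to \<open>4 * m * s < r\<close>.
\<close>

lemma label_gadget_numbers:
  fixes m t :: nat
  defines "q \<equiv> t ^ (2 * m)" and "s \<equiv> t ^ (m - 1)"
  defines "r \<equiv> 5 * m * s"
  assumes m: "m > 0" and t: "10 * m \<le> t"
  shows "0 < r" "0 < s" "s \<le> q" "r \<le> q"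
    "(2 * r * q) ^ (2 * r * s) * s ^ (2 * r * r) < q ^ (r * r)"
    "t \<le> 4 * r * q + 1" "4 * r * q + 1 \<le> 21 * m * t ^ (3 * m)"
proof -
  have t2: "t \<ge> 2" using m t by simp
  have ts: "t * s = t ^ m" using m by (simp add: s_def power_eq_if)
  show pos: "0 < s" "0 < r" using t2 m by (simp_all add: s_def r_def)
  \<comment> \<open>The bound \<open>10 * m \<le> t\<close> lets one extra factor \<open>t\<close>
    absorb the constant.\<close>
  have "2 * r = 10 * m * s" by (simp add: r_def)
  also have "\<dots> \<le> t * s" using t by (rule mult_le_mono1)
  also have "\<dots> \<le> q" unfolding ts q_def using t2 by (intro power_increasing) auto
  finally have rq: "2 * r \<le> q" .
  then show "r \<le> q" by simp
  have "s \<le> r" using m by (simp add: r_def)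
  then show "s \<le> q" using \<open>r \<le> q\<close> by simp
  have "(2 * r * q) ^ (2 * r * s) \<le> (q * q) ^ (2 * r * s)"
    using rq by (intro power_mono mult_le_mono1) auto
  also have "\<dots> = t ^ (8 * m * r * s)"
    by (simp add: q_def algebra_simps flip: power_mult power_add)
  \<comment> \<open>The factor 5 in \<open>r\<close> gives \<open>4 * m * s < r\<close>, hence the
    strict inequality of exponents.\<close>
  also have "\<dots> < t ^ (2 * r * r)"
    using t2 m pos by (intro power_strict_increasing) (auto simp: r_def)
  finally have "(2 * r * q) ^ (2 * r * s) * s ^ (2 * r * r) < t ^ (2 * r * r) * s ^ (2 * r * r)"
    using pos by simp
  also have "\<dots> = q ^ (r * r)"
    by (simp add: ts q_def mult.assoc mult.left_commute flip: power_mult_distrib power_mult)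
  finally show "(2 * r * q) ^ (2 * r * s) * s ^ (2 * r * r) < q ^ (r * r)" .
  have "t ^ 1 \<le> q" unfolding q_def using t2 m by (intro power_increasing) auto
  also have "q \<le> 4 * r * q" using pos by simp
  finally show "t \<le> 4 * r * q + 1" by simp
  have "s * q \<le> t ^ m * q"
    unfolding s_def using t2 by (intro mult_le_mono1 power_increasing) auto
  also have "\<dots> = t ^ (3 * m)"
    by (simp add: q_def flip: power_add)
  finally have "20 * m * (s * q) \<le> 20 * m * t ^ (3 * m)"
    by (rule mult_le_mono2)
  moreover have "4 * r * q = 20 * m * (s * q)" by (simp add: r_def)
  moreover have "21 * m * t ^ (3 * m) = 20 * m * t ^ (3 * m) + m * t ^ (3 * m)" by simp
  moreover have "1 \<le> m * t ^ (3 * m)" using m t2 by simp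
  ultimately show "4 * r * q + 1 \<le> 21 * m * t ^ (3 * m)"
    by linarith
qed

text \<open>Raising \<open>t ^ (3 * m)\<close> to the power \<open>1 / 3 - \<epsilon>\<close> gives
  exponent \<open>m - 3 * m * \<epsilon>\<close>, which is at most \<open>m - 1\<close>. The
  constant only shrinks, as the power is below 1; for a nonpositive power the left side is at most
  1.\<close>

lemma powr_le_of_le_mult_power:
  fixes n m t :: nat and \<epsilon> :: real
  assumes "0 < n" "n \<le> 21 * m * t ^ (3 * m)" "0 < m" "0 < t" "0 < \<epsilon>" "1 \<le> 3 * m * \<epsilon>"
  shows "real n powr (1 / 3 - \<epsilon>) \<le> 21 * m * real t ^ (m - 1)"
proof (cases "1 / 3 - \<epsilon> \<le> 0")
  case True
  have "real n powr (1 / 3 - \<epsilon>) \<le> real n powr 0"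
    using True assms(1) by (intro powr_mono) auto
  also have "\<dots> \<le> real (21 * m * t ^ (m - 1))"
    using assms by (simp del: of_nat_mult of_nat_power)
  finally show ?thesis by simp
next
  case False
  let ?e = "1 / 3 - \<epsilon>"
  have "real n \<le> real (21 * m * t ^ (3 * m))"
    using assms(2) by (simp only: of_nat_le_iff)
  then have "real n powr ?e \<le> real (21 * m * t ^ (3 * m)) powr ?e"
    using False by (intro powr_mono2) auto
  also have "\<dots> = real (21 * m) powr ?e * real t powr (real (3 * m) * ?e)"
    using assms(4) by (simp add: powr_mult powr_powr flip: powr_realpow)
  also have "\<dots> \<le> real (21 * m) powr 1 * real t powr (real m - 1)"
    using assms False by (intro mult_mono powr_mono) (auto simp: algebra_simps)
  also have "real t powr (real m - 1) = real t ^ (m - 1)"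
    using assms by (simp add: of_nat_diff flip: powr_realpow)
  finally show ?thesis by simp
qed

theorem theorem21:
  fixes \<epsilon> :: real
  assumes "\<epsilon> > 0"
  shows "\<exists>C>0. \<forall>N::nat. \<exists>n\<ge>N. \<exists>(V :: nat set) (E :: nat set set) (S :: nat \<Rightarrow> nat \<Rightarrow> nat set).
           cc_instance V E S \<and> card V = n \<and> safely_connected V S E \<and>
           flow_lp_gap V E S \<ge> C * real n powr (1 / 3 - \<epsilon>)"
proof -
  \<comment> \<open>The parameter \<open>m\<close> depends on \<open>\<epsilon>\<close> alone, so
    the final constant is independent of \<open>N\<close>.\<close>
  obtain m0 :: nat where "1 / (3 * \<epsilon>) \<le> m0" using real_arch_simple by blast
  define m where "m = Suc m0"
  have m: "m > 0" "1 \<le> 3 * m * \<epsilon>"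
  proof -
    have "1 / (3 * \<epsilon>) \<le> m" using \<open>1 / (3 * \<epsilon>) \<le> m0\<close> by (simp add: m_def)
    then show "1 \<le> 3 * m * \<epsilon>" using assms by (simp add: field_simps)
  qed (simp add: m_def)
  \<comment> \<open>Hub, terminals and labels are encoded as naturals by different constructors of
    one countable type.\<close>
  define hub :: nat where
    "hub = to_nat (None :: ((bool \<times> nat \<times> nat) + (bool \<times> nat \<times> nat)) option)"
  define terminal :: "bool \<Rightarrow> nat \<Rightarrow> nat \<Rightarrow> nat" where
    "terminal b i a = to_nat (Some (Inl (b, i, a)) :: ((bool \<times> nat \<times> nat) + (bool \<times> nat \<times> nat)) option)"
    for b i a
  define label :: "bool \<Rightarrow> nat \<Rightarrow> nat \<Rightarrow> nat" where
    "label b i l = to_nat (Some (Inr (b, i, l)) :: ((bool \<times> nat \<times> nat) + (bool \<times> nat \<times> nat)) option)"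
    for b i l
  show ?thesis
  \<comment> \<open>The constant is the \<open>2 / 7\<close> of the gap bound divided by the
    \<open>21 * m\<close> of the power estimate.\<close>
  proof (rule exI[of _ "2 / (147 * real m)"], intro conjI allI)
    show "2 / (147 * real m) > 0" using m by simp
    fix N :: nat
    \<comment> \<open>This ensures both \<open>10 * m \<le> t\<close> and \<open>N \<le> t\<close>,
      the latter making the instance large enough.\<close>
    define t where "t = 10 * m + N"
    define q where "q = t ^ (2 * m)"
    define s where "s = t ^ (m - 1)"
    define r where "r = 5 * m * s"
    have "10 * m \<le> t" by (simp add: t_def)
    note numbers = label_gadget_numbers[OF m(1) this, folded q_def s_def, folded r_def]
    obtain w where w: "\<And>X. X \<subseteq> UNIV \<times> {..<r} \<times> {..<q} \<Longrightarrow> \<forall>i<r. \<forall>j<r. covers q w X i j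
        \<Longrightarrow> 2 * r * s < card X"
      using exists_shifts_without_small_cover numbers(2,3,5) by blast
    interpret label_gadget hub terminal label r q w
      by unfold_locales (use numbers in \<open>auto simp: hub_def terminal_def label_def\<close>)
    let ?n = "4 * r * q + 1"
    have "real ?n powr (1 / 3 - \<epsilon>) \<le> 21 * m * real s"
      using powr_le_of_le_mult_power[of ?n m t \<epsilon>] numbers m assms
      by (simp add: s_def t_def)
    then have "2 / (147 * real m) * real ?n powr (1 / 3 - \<epsilon>) \<le> 2 / (147 * real m) * (21 * m * real s)"
      by (rule mult_left_mono) simp
    also have "\<dots> = 2 / 7 * real s" using m by simp
    also have "\<dots> \<le> flow_lp_gap verts edges allowed"
      using w numbers(4) by (rule flow_lp_gap_ge)
    finally have "2 / (147 * real m) * real ?n powr (1 / 3 - \<epsilon>) \<le> flow_lp_gap verts edges allowed" .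
    moreover have "N \<le> ?n" using numbers(6) by (simp add: t_def)
    ultimately show "\<exists>n\<ge>N. \<exists>V E S. cc_instance V E S \<and> card V = n \<and> safely_connected V S E \<and>
        2 / (147 * real m) * real n powr (1 / 3 - \<epsilon>) \<le> flow_lp_gap (V :: nat set) E S"
      using cc_instance card_verts safely_connected by blast
  qed
qed

end
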